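(* Under the identification of $B_1$-modules with decent ordered sets (given by $a\leq b\iff a+b=b$, and conversely $a+b=a\vee b$, $0a=0$, $1a=a$), the category $\mathcal{Z}_f$ of finite $B_1$-modules is identified with the category of nonempty finite lattices. That is, the ordered set associated with a finite $B_1$-module is a nonempty finite lattice, and every nonempty finite lattice is the ordered set associated with a (unique) $B_1$-module structure, the morphisms of $B_1$-modules corresponding to the maps that preserve binary joins and the least element.
   Context: $B_1=\{0,1\}$ with addition $0+0=0$, $0+1=1+0=1+1=1$ and the usual multiplication. A $B_1$-module is a commutative monoid $(M,+)$ with neutral element $0$ together with a map $B_1\times M\to M$, $(\lambda,x)\mapsto\lambda x$, such that $(\lambda+\mu)x=\lambda x+\mu x$, $\lambda(x+y)=\lambda x+\lambda y$, $1x=x$, $0x=0$; morphisms are the maps preserving $+$ and the external law. A pointed ordered set $(E,\leq,0)$ is called decent if $0$ is its least element and any two elements have a least upper bound; morphisms of decent ordered sets are the maps preserving binary least upper bounds and the least element. The category of $B_1$-modules is isomorphic to the category of decent ordered sets via $a\leq b\iff a+b=b$. A lattice is an ordered set in which any two elements have a least upper bound and a greatest lower bound; the morphisms considered here between finite nonempty lattices are those of decent ordered sets. *)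

theory Defs
  imports "HOL-Algebra.Group" "HOL-Algebra.Lattice"
begin

section \<open>The semiring \<open>B\<^sub>1\<close> and its modules\<close>

datatype b1 = Zero | One

instantiation b1 :: comm_semiring_1
begin

definition zero_b1 :: b1 where "0 = Zero"
definition one_b1 :: b1 where "1 = One"
definition plus_b1 :: "b1 \<Rightarrow> b1 \<Rightarrow> b1" where
  "a + b = (if a = Zero \<and> b = Zero then Zero else One)"
definition times_b1 :: "b1 \<Rightarrow> b1 \<Rightarrow> b1" where
  "a * b = (if a = One \<and> b = One then One else Zero)"

instance
proof
  fix a b c :: b1
  show "a + b + c = a + (b + c)" "a + b = b + a" "0 + a = a"
    "a * b * c = a * (b * c)" "a * b = b * a" "1 * a = a"
    "(a + b) * c = a * c + b * c" "0 * a = 0" "a * 0 = 0" "(0::b1) \<noteq> 1"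
    by (cases a; cases b; cases c;
        simp add: zero_b1_def one_b1_def plus_b1_def times_b1_def)+
qed

end

record 'a b1_module = "'a partial_object" +
  add :: "'a \<Rightarrow> 'a \<Rightarrow> 'a"
  zero :: 'a
  smult :: "b1 \<Rightarrow> 'a \<Rightarrow> 'a"

text \<open>
  The two \<open>extensional\<close> axioms only fix the irrelevant values of the operations outside the
  carrier, so that equality of records is equality of module structures.
\<close>

locale B1_module =
  fixes M :: "'a b1_module"
  assumes comm_monoid_add: "comm_monoid \<lparr>carrier = carrier M, mult = add M, one = zero M\<rparr>"
    and smult_closed: "x \<in> carrier M \<Longrightarrow> smult M c x \<in> carrier M"
    and smult_l_distr: "x \<in> carrier M \<Longrightarrow> smult M (c + d) x = add M (smult M c x) (smult M d x)"
    and smult_r_distr: "\<lbrakk>x \<in> carrier M; y \<in> carrier M\<rbrakk> \<Longrightarrow>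
          smult M c (add M x y) = add M (smult M c x) (smult M c y)"
    and smult_one: "x \<in> carrier M \<Longrightarrow> smult M 1 x = x"
    and smult_zero: "x \<in> carrier M \<Longrightarrow> smult M 0 x = zero M"
    and add_extensional: "case_prod (add M) \<in> extensional (carrier M \<times> carrier M)"
    and smult_extensional: "smult M c \<in> extensional (carrier M)"

definition B1_hom :: "'a b1_module \<Rightarrow> 'b b1_module \<Rightarrow> ('a \<Rightarrow> 'b) set" where
  "B1_hom M N = {f \<in> carrier M \<rightarrow>\<^sub>E carrier N.
     (\<forall>x\<in>carrier M. \<forall>y\<in>carrier M. f (add M x y) = add N (f x) (f y)) \<and>
     (\<forall>c. \<forall>x\<in>carrier M. f (smult M c x) = smult N c (f x))}"


section \<open>Decent ordered sets and finite lattices\<close>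

text \<open>\<open>e\<close> is the base point of the pointed ordered set.\<close>

definition decent :: "'a gorder \<Rightarrow> 'a \<Rightarrow> bool" where
  "decent E e \<longleftrightarrow> partial_order E \<and> least E e (carrier E) \<and>
     (\<forall>x\<in>carrier E. \<forall>y\<in>carrier E. \<exists>s. is_lub E s {x, y})"

definition decent_hom :: "'a gorder \<Rightarrow> 'a \<Rightarrow> 'b gorder \<Rightarrow> 'b \<Rightarrow> ('a \<Rightarrow> 'b) set" where
  "decent_hom E e F e' = {f \<in> carrier E \<rightarrow>\<^sub>E carrier F.
     (\<forall>x\<in>carrier E. \<forall>y\<in>carrier E. f (x \<squnion>\<^bsub>E\<^esub> y) = f x \<squnion>\<^bsub>F\<^esub> f y) \<and> f e = e'}"

text \<open>
  The last conjunct makes the order a relation on the carrier, so that equality of records is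
  equality of ordered sets.
\<close>

definition nonempty_finite_lattice :: "'a gorder \<Rightarrow> bool" where
  "nonempty_finite_lattice L \<longleftrightarrow> lattice L \<and> finite (carrier L) \<and> carrier L \<noteq> {} \<and>
     (\<forall>x y. x \<sqsubseteq>\<^bsub>L\<^esub> y \<longrightarrow> x \<in> carrier L \<and> y \<in> carrier L)"


section \<open>The identification\<close>

definition order_of :: "'a b1_module \<Rightarrow> 'a gorder" where
  "order_of M = \<lparr>carrier = carrier M, eq = (=),
     le = (\<lambda>a b. a \<in> carrier M \<and> b \<in> carrier M \<and> add M a b = b)\<rparr>"

definition module_of :: "'a gorder \<Rightarrow> 'a b1_module" where
  "module_of L = \<lparr>carrier = carrier L,
     add = (\<lambda>a b. if a \<in> carrier L \<and> b \<in> carrier L then a \<squnion>\<^bsub>L\<^esub> b else undefined),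
     zero = \<bottom>\<^bsub>L\<^esub>,
     smult = (\<lambda>c. \<lambda>x\<in>carrier L. if c = 0 then \<bottom>\<^bsub>L\<^esub> else x)\<rparr>"


section \<open>Categories\<close>

text \<open>
  Hom-sets are indexed by source and target; \<open>Comp C X Y Z g f\<close> is the composite of
  \<open>f\<close> from \<open>X\<close> to \<open>Y\<close> and \<open>g\<close> from \<open>Y\<close> to \<open>Z\<close>.
\<close>

record ('o, 'm) cat =
  Obj :: "'o set"
  Hom :: "'o \<Rightarrow> 'o \<Rightarrow> 'm set"
  Ident :: "'o \<Rightarrow> 'm"
  Comp :: "'o \<Rightarrow> 'o \<Rightarrow> 'o \<Rightarrow> 'm \<Rightarrow> 'm \<Rightarrow> 'm"

locale category =
  fixes C :: "('o, 'm) cat"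
  assumes Ident_in_Hom: "X \<in> Obj C \<Longrightarrow> Ident C X \<in> Hom C X X"
    and Comp_in_Hom: "\<lbrakk>X \<in> Obj C; Y \<in> Obj C; Z \<in> Obj C; f \<in> Hom C X Y; g \<in> Hom C Y Z\<rbrakk>
          \<Longrightarrow> Comp C X Y Z g f \<in> Hom C X Z"
    and Comp_Ident_right: "\<lbrakk>X \<in> Obj C; Y \<in> Obj C; f \<in> Hom C X Y\<rbrakk>
          \<Longrightarrow> Comp C X X Y f (Ident C X) = f"
    and Comp_Ident_left: "\<lbrakk>X \<in> Obj C; Y \<in> Obj C; f \<in> Hom C X Y\<rbrakk>
          \<Longrightarrow> Comp C X Y Y (Ident C Y) f = f"
    and Comp_assoc: "\<lbrakk>W \<in> Obj C; X \<in> Obj C; Y \<in> Obj C; Z \<in> Obj C;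
            f \<in> Hom C W X; g \<in> Hom C X Y; h \<in> Hom C Y Z\<rbrakk>
          \<Longrightarrow> Comp C W X Z (Comp C X Y Z h g) f = Comp C W Y Z h (Comp C W X Y g f)"

locale cat_functor = C: category C + D: category D
  for C :: "('o, 'm) cat" and D :: "('p, 'n) cat" +
  fixes FO :: "'o \<Rightarrow> 'p" and FM :: "'o \<Rightarrow> 'o \<Rightarrow> 'm \<Rightarrow> 'n"
  assumes FO_Obj: "X \<in> Obj C \<Longrightarrow> FO X \<in> Obj D"
    and FM_Hom: "\<lbrakk>X \<in> Obj C; Y \<in> Obj C; f \<in> Hom C X Y\<rbrakk> \<Longrightarrow> FM X Y f \<in> Hom D (FO X) (FO Y)"
    and FM_Ident: "X \<in> Obj C \<Longrightarrow> FM X X (Ident C X) = Ident D (FO X)"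
    and FM_Comp: "\<lbrakk>X \<in> Obj C; Y \<in> Obj C; Z \<in> Obj C; f \<in> Hom C X Y; g \<in> Hom C Y Z\<rbrakk>
          \<Longrightarrow> FM X Z (Comp C X Y Z g f) = Comp D (FO X) (FO Y) (FO Z) (FM Y Z g) (FM X Y f)"

locale cat_isomorphism = F: cat_functor C D FO FM + G: cat_functor D C GO GM
  for C :: "('o, 'm) cat" and D :: "('p, 'n) cat" and FO FM GO GM +
  assumes GO_FO: "X \<in> Obj C \<Longrightarrow> GO (FO X) = X"
    and FO_GO: "U \<in> Obj D \<Longrightarrow> FO (GO U) = U"
    and GM_FM: "\<lbrakk>X \<in> Obj C; Y \<in> Obj C; f \<in> Hom C X Y\<rbrakk> \<Longrightarrow> GM (FO X) (FO Y) (FM X Y f) = f"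
    and FM_GM: "\<lbrakk>U \<in> Obj D; V \<in> Obj D; g \<in> Hom D U V\<rbrakk> \<Longrightarrow> FM (GO U) (GO V) (GM U V g) = g"

text \<open>
  The objects of the next two categories are the structures whose carrier is a subset of the
  type \<open>'a\<close>, which plays the role of a universe.
\<close>

definition fin_B1_Mod :: "('a b1_module, 'a \<Rightarrow> 'a) cat" where
  "fin_B1_Mod = \<lparr>Obj = {M. B1_module M \<and> finite (carrier M)},
     Hom = B1_hom,
     Ident = (\<lambda>M. \<lambda>x\<in>carrier M. x),
     Comp = (\<lambda>M N P g f. compose (carrier M) g f)\<rparr>"

definition fin_Lat :: "('a gorder, 'a \<Rightarrow> 'a) cat" where
  "fin_Lat = \<lparr>Obj = {L. nonempty_finite_lattice L},
     Hom = (\<lambda>L K. decent_hom L \<bottom>\<^bsub>L\<^esub> K \<bottom>\<^bsub>K\<^esub>),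
     Ident = (\<lambda>L. \<lambda>x\<in>carrier L. x),
     Comp = (\<lambda>L K J g f. compose (carrier L) g f)\<rparr>"

end

theory Submission
  imports Defs
begin

text \<open>In \<open>B\<^sub>1\<close> one has \<open>1 + 1 = 1\<close>, which forces \<open>x + x = x\<close> in every module; addition is therefore
  the binary join of the associated order, whose least element is \<open>0\<close>. The external law carries no
  further information, since it is determined by \<open>0\<close>. In the finite case binary meets come for free,
  as joins of the common lower bounds.\<close>

section \<open>Scalars, and uniqueness of joins and bottoms\<close>

lemma b1_cases: "c = 0 \<or> c = (1 :: b1)"
  by (cases c) (simp_all add: zero_b1_def one_b1_def)

text \<open>Idempotence \<open>1 + 1 = 1\<close> of the scalars, written with \<open>2\<close>
  because the simplifier turns \<open>1 + 1\<close> into that numeral.\<close>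

lemma b1_two: "2 = (1 :: b1)"
  unfolding one_add_one[symmetric] by (simp add: one_b1_def plus_b1_def)

lemma order_of_simps [simp]:
  "carrier (order_of M) = carrier M"
  "x \<sqsubseteq>\<^bsub>order_of M\<^esub> y \<longleftrightarrow> x \<in> carrier M \<and> y \<in> carrier M \<and> add M x y = y"
  "x .=\<^bsub>order_of M\<^esub> y \<longleftrightarrow> x = y"
  by (simp_all add: order_of_def)

lemma carrier_module_of [simp]: "carrier (module_of L) = carrier L"
  by (simp add: module_of_def)

text \<open>The join is a Hilbert choice among least upper bounds. These are unique in a partial
  order, so exhibiting one determines the join; \<open>bottom_eq\<close> is the analogue for least
  elements.\<close>

lemma (in partial_order) join_eq:
  assumes "is_lub L s {x, y}"
  shows "x \<squnion> y = s"
  unfolding join_def sup_def using assms by (rule some_equality) (rule least_unique[OF _ assms])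

lemma (in partial_order) bottom_eq:
  assumes "least L e (carrier L)"
  shows "\<bottom> = e"
  unfolding bottom_def using assms by (rule some_equality) (rule least_unique[OF _ assms])

section \<open>From modules to finite lattices\<close>

context B1_module
begin

lemma zero_closed [simp]: "zero M \<in> carrier M"
  using comm_monoid.axioms(1)[OF comm_monoid_add] by (simp add: monoid_def)

lemma add_closed [simp]: "x \<in> carrier M \<Longrightarrow> y \<in> carrier M \<Longrightarrow> add M x y \<in> carrier M"
  using comm_monoid.axioms(1)[OF comm_monoid_add] by (simp add: monoid_def)

lemma add_assoc:
  "x \<in> carrier M \<Longrightarrow> y \<in> carrier M \<Longrightarrow> z \<in> carrier M \<Longrightarrow> add M (add M x y) z = add M x (add M y z)"
  using comm_monoid.axioms(1)[OF comm_monoid_add] by (simp add: monoid_def)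

lemma add_comm: "x \<in> carrier M \<Longrightarrow> y \<in> carrier M \<Longrightarrow> add M x y = add M y x"
  using comm_monoid.m_comm[OF comm_monoid_add] by simp

lemma zero_add: "x \<in> carrier M \<Longrightarrow> add M (zero M) x = x"
  using comm_monoid.axioms(1)[OF comm_monoid_add] by (simp add: monoid_def)

lemma add_idem: "x \<in> carrier M \<Longrightarrow> add M x x = x"
  using smult_l_distr[of x 1 1] by (simp add: b1_two smult_one)

text \<open>Each order axiom comes from one law of addition: reflexivity from idempotence,
  transitivity from associativity, antisymmetry from commutativity.\<close>

lemma partial_order_order_of: "partial_order (order_of M)"
proof
  show "(.=\<^bsub>order_of M\<^esub>) = (=)"
    by (simp add: order_of_def)
next
  fix x y z
  assume "x \<in> carrier (order_of M)" "y \<in> carrier (order_of M)" "z \<in> carrier (order_of M)"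
    and "x \<sqsubseteq>\<^bsub>order_of M\<^esub> y" "y \<sqsubseteq>\<^bsub>order_of M\<^esub> z"
  then show "x \<sqsubseteq>\<^bsub>order_of M\<^esub> z"
    by simp (metis add_assoc)
next
  fix x y
  assume "x \<sqsubseteq>\<^bsub>order_of M\<^esub> y" "y \<sqsubseteq>\<^bsub>order_of M\<^esub> x"
  then show "x .=\<^bsub>order_of M\<^esub> y"
    by simp (metis add_comm)
qed (auto simp: add_idem)

text \<open>The sum is an upper bound since x + (x + y) = (x + x) + y = x + y, and symmetrically for
  y. If z absorbs x and y, then (x + y) + z = x + (y + z) = z.\<close>

lemma is_lub_add:
  assumes x: "x \<in> carrier M" and y: "y \<in> carrier M"
  shows "is_lub (order_of M) (add M x y) {x, y}"
proof (rule least_UpperI)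
  fix z assume "z \<in> {x, y}"
  then show "z \<sqsubseteq>\<^bsub>order_of M\<^esub> add M x y"
    using x y by simp (metis add_assoc add_comm add_idem)
next
  fix z assume "z \<in> Upper (order_of M) {x, y}"
  then have "z \<in> carrier M" "add M x z = z" "add M y z = z"
    using x y by (auto simp: Upper_def)
  then show "add M x y \<sqsubseteq>\<^bsub>order_of M\<^esub> z"
    using x y by (simp add: add_assoc)
qed (use x y in auto)

lemma least_zero: "least (order_of M) (zero M) (carrier (order_of M))"
  by (simp add: least_def zero_add)

lemma join_order_of:
  "x \<in> carrier M \<Longrightarrow> y \<in> carrier M \<Longrightarrow> x \<squnion>\<^bsub>order_of M\<^esub> y = add M x y"
  using partial_order.join_eq[OF partial_order_order_of is_lub_add] .

lemma bottom_order_of: "\<bottom>\<^bsub>order_of M\<^esub> = zero M"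
  using partial_order.bottom_eq[OF partial_order_order_of least_zero] .

lemma decent_order_of: "decent (order_of M) (zero M)"
  unfolding decent_def using partial_order_order_of least_zero is_lub_add by auto

text \<open>On the carrier, addition is recovered as the join, and the external law from its two
  cases, scalar 0 and scalar 1. Off the carrier, both sides are \<open>undefined\<close> by the
  extensionality axioms, so the records are equal and not merely isomorphic.\<close>

lemma module_of_order_of: "module_of (order_of M) = M"
proof (rule b1_module.equality)
  show "add (module_of (order_of M)) = add M"
  proof (intro ext)
    fix x y
    show "add (module_of (order_of M)) x y = add M x y"
      using add_extensional by (auto simp: module_of_def join_order_of extensional_def)
  qed
  show "smult (module_of (order_of M)) = smult M"
  proof (intro ext)
    fix c x
    show "smult (module_of (order_of M)) c x = smult M c x"
      using smult_extensional[of c] b1_cases[of c]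
      by (cases "x \<in> carrier M")
        (auto simp: module_of_def bottom_order_of extensional_def smult_zero smult_one)
  qed
qed (simp_all add: module_of_def bottom_order_of)

end

text \<open>Finite nonempty joins follow from binary ones. The common lower bounds of two elements
  form such a finite nonempty set, and their join is the meet.\<close>

lemma lattice_if_finite_decent:
  fixes L :: "'a gorder" (structure)
  assumes "decent L e" and fin: "finite (carrier L)"
  shows "lattice L"
proof -
  interpret partial_order L
    using assms by (simp add: decent_def)
  interpret upper_semilattice L
    by unfold_locales (use assms in \<open>auto simp: decent_def\<close>)
  have e: "least L e (carrier L)"
    using assms by (simp add: decent_def)
  show ?thesis
  proof unfold_locales
    fix x y
    assume xy: "x \<in> carrier L" "y \<in> carrier L"
    let ?B = "Lower L {x, y}"
    \<comment> \<open>The base point makes the set of lower bounds nonempty, so that its join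
      exists.\<close>
    have "e \<in> ?B"
      using e xy by (auto simp: least_def Lower_def)
    then have lub: "is_lub L (\<Squnion>?B) ?B"
      by (intro finite_sup_least) (auto intro: finite_subset[OF _ fin])
    have "greatest L (\<Squnion>?B) ?B"
    proof (rule greatest_LowerI)
      \<comment> \<open>Both x and y are upper bounds of \<open>?B\<close>, hence lie above its
        least upper bound.\<close>
      fix z assume "z \<in> {x, y}"
      then have "z \<in> Upper L ?B"
        using xy by (auto intro!: Upper_memI simp: Lower_def)
      then show "\<Squnion>?B \<sqsubseteq> z"
        by (rule least_le[OF lub])
    next
      fix z assume "z \<in> ?B"
      then show "z \<sqsubseteq> \<Squnion>?B"
        using least_Upper_above[OF lub] by simp
    qed (use xy lub in auto)
    then show "\<exists>i. greatest L i ?B" ..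
  qed
qed

lemma (in B1_module) nonempty_finite_lattice_order_of:
  assumes "finite (carrier M)"
  shows "nonempty_finite_lattice (order_of M)"
proof -
  have "carrier M \<noteq> {}"
    using zero_closed by blast
  then show ?thesis
    using lattice_if_finite_decent[OF decent_order_of] assms
    by (simp add: nonempty_finite_lattice_def)
qed

section \<open>From finite lattices to modules\<close>

locale finite_lattice = lattice L for L :: "'a gorder" (structure) +
  assumes finite_carrier: "finite (carrier L)" and carrier_nonempty: "carrier L \<noteq> {}"
begin

text \<open>A finite nonempty carrier has an infimum, and this infimum is the least element that
  \<open>\<bottom>\<close> selects.\<close>

lemma least_bottom: "least L \<bottom> (carrier L)"
proof -
  have "greatest L (\<Sqinter>carrier L) (Lower L (carrier L))"
    using finite_inf_greatest[OF finite_carrier _ carrier_nonempty] by simp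
  then have "least L (\<Sqinter>carrier L) (carrier L)"
    by (auto simp: least_def greatest_def Lower_def)
  then show ?thesis
    using bottom_eq by simp
qed

lemma bottom_carrier [simp]: "\<bottom> \<in> carrier L"
  using least_bottom by simp

lemma le_iff_join_eq: "x \<in> carrier L \<Longrightarrow> y \<in> carrier L \<Longrightarrow> x \<sqsubseteq> y \<longleftrightarrow> x \<squnion> y = y"
  \<comment> \<open>Despite its name, \<open>le_iff_meet\<close> characterizes the order by
    joins.\<close>
  by (rule le_iff_meet)

lemma bottom_join: "x \<in> carrier L \<Longrightarrow> \<bottom> \<squnion> x = x"
  using least_bottom by (simp add: le_iff_join_eq[symmetric] least_def)

lemma join_bottom: "x \<in> carrier L \<Longrightarrow> x \<squnion> \<bottom> = x"
  by (simp add: bottom_join join_comm[of L x])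

lemma join_idem: "x \<in> carrier L \<Longrightarrow> x \<squnion> x = x"
  by (simp add: le_iff_join_eq[symmetric])

lemma join_assoc:
  "x \<in> carrier L \<Longrightarrow> y \<in> carrier L \<Longrightarrow> z \<in> carrier L \<Longrightarrow> x \<squnion> y \<squnion> z = x \<squnion> (y \<squnion> z)"
  using weak_join_assoc by (simp add: eq_is_equal)

lemma decent_bottom: "decent L \<bottom>"
  unfolding decent_def using partial_order_axioms least_bottom sup_of_two_exists by blast

end

lemma finite_lattice_if_nonempty_finite_lattice:
  "nonempty_finite_lattice L \<Longrightarrow> finite_lattice L"
  by (simp add: nonempty_finite_lattice_def finite_lattice_def finite_lattice_axioms_def)

lemma B1_module_module_of:
  fixes L :: "'a gorder"
  assumes "finite_lattice L"
  shows "B1_module (module_of L)"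
proof -
  interpret finite_lattice L by fact
  show ?thesis
  proof (rule B1_module.intro)
    show "comm_monoid \<lparr>carrier = carrier (module_of L), mult = add (module_of L), one = zero (module_of L)\<rparr>"
      by (rule comm_monoidI) (auto simp: module_of_def bottom_join join_assoc intro: join_comm)
    fix c d :: b1 and x y :: 'a
    show "smult (module_of L) c x \<in> carrier (module_of L)" if "x \<in> carrier (module_of L)"
      using that by (simp add: module_of_def)
    show "smult (module_of L) (c + d) x = add (module_of L) (smult (module_of L) c x) (smult (module_of L) d x)"
      if "x \<in> carrier (module_of L)"
      \<comment> \<open>Equal scalars reduce to idempotence of the join, distinct ones to neutrality
        of the bottom.\<close>
      using that b1_cases[of c] b1_cases[of d]
      by (auto simp: module_of_def join_idem join_bottom bottom_join b1_two)
    show "smult (module_of L) c (add (module_of L) x y) =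
        add (module_of L) (smult (module_of L) c x) (smult (module_of L) c y)"
      if "x \<in> carrier (module_of L)" "y \<in> carrier (module_of L)"
      using that by (simp add: module_of_def join_idem)
  qed (auto simp: module_of_def extensional_def)
qed

text \<open>The relation of \<open>order_of\<close> holds only between carrier elements. Equality of
  records therefore rests on the last conjunct of \<open>nonempty_finite_lattice\<close>, which
  confines the given order to the carrier in the same way.\<close>

lemma order_of_module_of:
  fixes L :: "'a gorder" (structure)
  assumes "nonempty_finite_lattice L"
  shows "order_of (module_of L) = L"
proof -
  interpret finite_lattice L
    using assms by (rule finite_lattice_if_nonempty_finite_lattice)
  have le_carrier: "x \<sqsubseteq> y \<Longrightarrow> x \<in> carrier L \<and> y \<in> carrier L" for x y
    using assms by (simp add: nonempty_finite_lattice_def)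
  have "le (order_of (module_of L)) = le L"
  proof (intro ext)
    fix x y
    have "x \<sqsubseteq>\<^bsub>order_of (module_of L)\<^esub> y \<longleftrightarrow>
        x \<in> carrier L \<and> y \<in> carrier L \<and> x \<squnion> y = y"
      by (auto simp: module_of_def)
    also have "\<dots> \<longleftrightarrow> x \<sqsubseteq> y"
      using le_iff_join_eq le_carrier by blast
    finally show "(x \<sqsubseteq>\<^bsub>order_of (module_of L)\<^esub> y) = (x \<sqsubseteq> y)" .
  qed
  then show ?thesis
    by (intro gorder.equality) (simp_all add: order_of_def eq_is_equal)
qed

section \<open>Comparison of morphisms\<close>

text \<open>Addition is the join, and compatibility with the external law amounts to preserving
  zero: scalar 1 imposes nothing, scalar 0 says exactly this. The hom-sets are literally equal, so
  the functors can act as the identity on morphisms.\<close>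

lemma B1_hom_eq_decent_hom:
  assumes "B1_module M" "B1_module N"
  shows "B1_hom M N = decent_hom (order_of M) \<bottom>\<^bsub>order_of M\<^esub> (order_of N) \<bottom>\<^bsub>order_of N\<^esub>"
proof -
  interpret M: B1_module M by fact
  interpret N: B1_module N by fact
  have smult_iff: "(\<forall>c. \<forall>x\<in>carrier M. f (smult M c x) = smult N c (f x)) \<longleftrightarrow> f (zero M) = zero N"
    if f: "f \<in> carrier M \<rightarrow>\<^sub>E carrier N" for f
  proof
    assume "\<forall>c. \<forall>x\<in>carrier M. f (smult M c x) = smult N c (f x)"
    then have "f (smult M 0 (zero M)) = smult N 0 (f (zero M))"
      by simp
    then show "f (zero M) = zero N"
      using PiE_mem[OF f] by (simp add: M.smult_zero N.smult_zero)
  next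
    assume "f (zero M) = zero N"
    then have "f (smult M c x) = smult N c (f x)" if "x \<in> carrier M" for c x
      using PiE_mem[OF f] b1_cases[of c] that
      by (auto simp: M.smult_zero N.smult_zero M.smult_one N.smult_one)
    then show "\<forall>c. \<forall>x\<in>carrier M. f (smult M c x) = smult N c (f x)"
      by blast
  qed
  have add_iff: "(\<forall>x\<in>carrier M. \<forall>y\<in>carrier M. f (add M x y) = add N (f x) (f y)) \<longleftrightarrow>
      (\<forall>x\<in>carrier M. \<forall>y\<in>carrier M. f (x \<squnion>\<^bsub>order_of M\<^esub> y) = f x \<squnion>\<^bsub>order_of N\<^esub> f y)"
    if f: "f \<in> carrier M \<rightarrow>\<^sub>E carrier N" for f
    using PiE_mem[OF f] by (simp add: M.join_order_of N.join_order_of)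
  show ?thesis
    unfolding B1_hom_def decent_hom_def M.bottom_order_of N.bottom_order_of order_of_simps(1)
    by (intro Collect_cong conj_cong refl add_iff smult_iff)
qed

section \<open>The two categories and their isomorphism\<close>

lemma category_fin_B1_Mod: "category (fin_B1_Mod :: ('a b1_module, 'a \<Rightarrow> 'a) cat)"
proof
  fix M :: "'a b1_module"
  assume "M \<in> Obj fin_B1_Mod"
  then interpret B1_module M by (simp add: fin_B1_Mod_def)
  show "Ident fin_B1_Mod M \<in> Hom fin_B1_Mod M M"
    by (simp add: fin_B1_Mod_def B1_hom_def smult_closed)
next
  fix M N P :: "'a b1_module" and f g
  assume "M \<in> Obj fin_B1_Mod" "f \<in> Hom fin_B1_Mod M N" "g \<in> Hom fin_B1_Mod N P"
  then interpret B1_module M by (simp add: fin_B1_Mod_def)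
  have f: "f \<in> B1_hom M N" and g: "g \<in> B1_hom N P"
    using \<open>f \<in> _\<close> \<open>g \<in> _\<close> by (simp_all add: fin_B1_Mod_def)
  \<comment> \<open>The laws for \<open>g\<close> hold on the carrier of \<open>N\<close>, so they
    apply only at values of \<open>f\<close> lying there.\<close>
  have "f x \<in> carrier N" if "x \<in> carrier M" for x
    using f that by (auto simp: B1_hom_def)
  then show "Comp fin_B1_Mod M N P g f \<in> Hom fin_B1_Mod M P"
    using f g by (auto simp: fin_B1_Mod_def B1_hom_def compose_def smult_closed)
next
  fix M N :: "'a b1_module" and f
  assume "f \<in> Hom fin_B1_Mod M N"
  then have "f \<in> carrier M \<rightarrow>\<^sub>E carrier N"
    by (simp add: fin_B1_Mod_def B1_hom_def)
  then show "Comp fin_B1_Mod M M N f (Ident fin_B1_Mod M) = f"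
    and "Comp fin_B1_Mod M N N (Ident fin_B1_Mod N) f = f"
    \<comment> \<open>Composites are restricted to the carrier; they agree with \<open>f\<close>
      everywhere because \<open>f\<close> is \<open>undefined\<close> outside it.\<close>
    by (auto simp: fin_B1_Mod_def compose_def fun_eq_iff PiE_def extensional_def)
next
  fix M N P Q :: "'a b1_module" and f g h
  assume "f \<in> Hom fin_B1_Mod M N"
  then have "f \<in> carrier M \<rightarrow> carrier N"
    by (auto simp: fin_B1_Mod_def B1_hom_def)
  then show "Comp fin_B1_Mod M N Q (Comp fin_B1_Mod N P Q h g) f =
      Comp fin_B1_Mod M P Q h (Comp fin_B1_Mod M N P g f)"
    by (simp add: fin_B1_Mod_def compose_assoc)
qed

lemma order_of_Obj: "M \<in> Obj fin_B1_Mod \<Longrightarrow> order_of M \<in> Obj fin_Lat"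
  by (simp add: fin_B1_Mod_def fin_Lat_def B1_module.nonempty_finite_lattice_order_of)

lemma module_of_Obj: "L \<in> Obj fin_Lat \<Longrightarrow> module_of L \<in> Obj fin_B1_Mod"
  by (simp add: fin_B1_Mod_def fin_Lat_def B1_module_module_of
      finite_lattice_if_nonempty_finite_lattice) (simp add: nonempty_finite_lattice_def)

lemma Hom_order_of:
  "M \<in> Obj fin_B1_Mod \<Longrightarrow> N \<in> Obj fin_B1_Mod \<Longrightarrow>
    Hom fin_Lat (order_of M) (order_of N) = Hom fin_B1_Mod M N"
  by (simp add: fin_B1_Mod_def fin_Lat_def B1_hom_eq_decent_hom)

lemma Hom_module_of:
  assumes "L \<in> Obj fin_Lat" "K \<in> Obj fin_Lat"
  shows "Hom fin_B1_Mod (module_of L) (module_of K) = Hom fin_Lat L K"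
proof -
  have "order_of (module_of L) = L" "order_of (module_of K) = K"
    using assms by (simp_all add: fin_Lat_def order_of_module_of)
  then show ?thesis
    using Hom_order_of[OF module_of_Obj module_of_Obj, OF assms] by simp
qed

lemma Ident_order_of: "Ident fin_Lat (order_of M) = Ident fin_B1_Mod M"
  by (simp add: fin_Lat_def fin_B1_Mod_def)

lemma Comp_order_of:
  "Comp fin_Lat (order_of M) (order_of N) (order_of P) = Comp fin_B1_Mod M N P"
  by (simp add: fin_Lat_def fin_B1_Mod_def)

lemma Ident_module_of: "Ident fin_B1_Mod (module_of L) = Ident fin_Lat L"
  by (simp add: fin_Lat_def fin_B1_Mod_def)

lemma Comp_module_of:
  "Comp fin_B1_Mod (module_of L) (module_of K) (module_of J) = Comp fin_Lat L K J"
  by (simp add: fin_Lat_def fin_B1_Mod_def)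

text \<open>Since \<open>module_of\<close> preserves hom-sets, identities and composition on the
  nose, each category law is pulled back from \<open>fin_B1_Mod\<close>.\<close>

lemma category_fin_Lat: "category (fin_Lat :: ('a gorder, 'a \<Rightarrow> 'a) cat)"
proof -
  interpret category "fin_B1_Mod :: ('a b1_module, 'a \<Rightarrow> 'a) cat"
    by (rule category_fin_B1_Mod)
  note transfer = module_of_Obj Hom_module_of Ident_module_of Comp_module_of
  show ?thesis
  proof
    fix L :: "'a gorder"
    assume "L \<in> Obj fin_Lat"
    then show "Ident fin_Lat L \<in> Hom fin_Lat L L"
      using Ident_in_Hom[of "module_of L"] by (simp add: transfer)
  next
    fix L K J :: "'a gorder" and f g
    assume "L \<in> Obj fin_Lat" "K \<in> Obj fin_Lat" "J \<in> Obj fin_Lat"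
      "f \<in> Hom fin_Lat L K" "g \<in> Hom fin_Lat K J"
    then show "Comp fin_Lat L K J g f \<in> Hom fin_Lat L J"
      using Comp_in_Hom[of "module_of L" "module_of K" "module_of J" f g] by (simp add: transfer)
  next
    fix L K :: "'a gorder" and f
    assume "L \<in> Obj fin_Lat" "K \<in> Obj fin_Lat" "f \<in> Hom fin_Lat L K"
    then show "Comp fin_Lat L L K f (Ident fin_Lat L) = f"
      and "Comp fin_Lat L K K (Ident fin_Lat K) f = f"
      using Comp_Ident_right[of "module_of L" "module_of K" f]
        Comp_Ident_left[of "module_of L" "module_of K" f]
      by (simp_all add: transfer)
  next
    fix L K J I :: "'a gorder" and f g h
    assume "L \<in> Obj fin_Lat" "K \<in> Obj fin_Lat" "J \<in> Obj fin_Lat" "I \<in> Obj fin_Lat"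
      "f \<in> Hom fin_Lat L K" "g \<in> Hom fin_Lat K J" "h \<in> Hom fin_Lat J I"
    then show "Comp fin_Lat L K I (Comp fin_Lat K J I h g) f =
        Comp fin_Lat L J I h (Comp fin_Lat L K J g f)"
      using Comp_assoc[of "module_of L" "module_of K" "module_of J" "module_of I" f g h]
      by (simp add: transfer)
  qed
qed

lemma cat_isomorphism_fin_B1_Mod_fin_Lat:
  "cat_isomorphism (fin_B1_Mod :: ('a b1_module, 'a \<Rightarrow> 'a) cat) fin_Lat
     order_of (\<lambda>_ _ f. f) module_of (\<lambda>_ _ f. f)"
proof -
  interpret M: category "fin_B1_Mod :: ('a b1_module, 'a \<Rightarrow> 'a) cat"
    by (rule category_fin_B1_Mod)
  interpret L: category "fin_Lat :: ('a gorder, 'a \<Rightarrow> 'a) cat"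
    by (rule category_fin_Lat)
  show ?thesis
  proof
    fix M :: "'a b1_module"
    assume "M \<in> Obj fin_B1_Mod"
    then show "module_of (order_of M) = M"
      by (simp add: fin_B1_Mod_def B1_module.module_of_order_of)
  next
    fix L :: "'a gorder"
    assume "L \<in> Obj fin_Lat"
    then show "order_of (module_of L) = L"
      by (simp add: fin_Lat_def order_of_module_of)
  qed (simp_all add: order_of_Obj module_of_Obj Hom_order_of Hom_module_of
      Ident_order_of Ident_module_of Comp_order_of Comp_module_of)
qed

text \<open>Uniqueness holds because any module is recovered from its order by
  \<open>module_of\<close>.\<close>

lemma ex1_B1_module_order_of_eq:
  fixes L :: "'a gorder"
  assumes "nonempty_finite_lattice L"
  shows "\<exists>!M. B1_module M \<and> order_of M = L"
proof
  show "B1_module (module_of L) \<and> order_of (module_of L) = L"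
    using assms
    by (simp add: B1_module_module_of order_of_module_of finite_lattice_if_nonempty_finite_lattice)
next
  fix M
  assume "B1_module M \<and> order_of M = L"
  then show "M = module_of L"
    by (auto simp: B1_module.module_of_order_of)
qed

theorem mainTheorem2:
  shows "cat_isomorphism (fin_B1_Mod :: ('a b1_module, 'a \<Rightarrow> 'a) cat) fin_Lat
           order_of (\<lambda>_ _ f. f) module_of (\<lambda>_ _ f. f)
    \<and> (\<forall>M :: 'a b1_module. B1_module M \<and> finite (carrier M) \<longrightarrow>
         nonempty_finite_lattice (order_of M) \<and> decent (order_of M) (zero M))
    \<and> (\<forall>L :: 'a gorder. nonempty_finite_lattice L \<longrightarrow>
         decent L \<bottom>\<^bsub>L\<^esub> \<and> (\<exists>!M. B1_module M \<and> order_of M = L))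
    \<and> (\<forall>(M :: 'a b1_module) (N :: 'b b1_module).
         B1_module M \<and> finite (carrier M) \<and> B1_module N \<and> finite (carrier N) \<longrightarrow>
         B1_hom M N = decent_hom (order_of M) \<bottom>\<^bsub>order_of M\<^esub> (order_of N) \<bottom>\<^bsub>order_of N\<^esub>)"
  by (intro conjI allI impI)
    (simp_all add: cat_isomorphism_fin_B1_Mod_fin_Lat ex1_B1_module_order_of_eq
      B1_module.nonempty_finite_lattice_order_of B1_module.decent_order_of B1_hom_eq_decent_hom
      finite_lattice.decent_bottom finite_lattice_if_nonempty_finite_lattice)

end
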